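(* For each integer $n \geq 0$, the polynomial $B_{2^k - v_n}(t)$ is reciprocal for every integer $k \geq 4n^2 + 6n + 3$, and the polynomial $B_{2^k - u_n}(t)$ is reciprocal for every integer $k \geq 4n^2 + 2n + 1$.
   Context: The Stern polynomials $B_n(t) \in \mathbb{Z}[t]$, $n \geq 0$, are defined by $B_0(t) = 0$, $B_1(t) = 1$, and for $n \geq 2$: $B_n(t) = t\,B_{n/2}(t)$ if $n$ is even, and $B_n(t) = B_{(n+1)/2}(t) + B_{(n-1)/2}(t)$ if $n$ is odd. For $n \geq 1$, $e(n) = \deg B_n(t)$, and $B_n(t)$ is called reciprocal if $B_n(t) = t^{e(n)} B_n\left(\frac{1}{t}\right)$. The integer sequences $(u_n)_{n \geq 0}$ and $(v_n)_{n \geq 0}$ are defined by $u_0 = 1$, $u_n = 2^{8n-2} u_{n-1} + 2^{4n} - 1$ for $n \geq 1$, and $v_0 = 5$, $v_n = 2^{8n+2} v_{n-1} - 2^{4n+2} + 1$ for $n \geq 1$. *)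

theory Defs
  imports "HOL-Computational_Algebra.Computational_Algebra"
begin

function stern_poly :: "nat \<Rightarrow> int poly" where
  "stern_poly n =
    (if n = 0 then 0
     else if n = 1 then 1
     else if even n then [:0, 1:] * stern_poly (n div 2)
     else stern_poly ((n + 1) div 2) + stern_poly ((n - 1) div 2))"
  by auto
termination
  by (relation "measure id") (auto elim!: oddE)

declare stern_poly.simps [simp del]

text \<open>
  The identity \<open>p(t) = t\<^sup>d p(1/t)\<close>, with \<open>d\<close> the degree of \<open>p\<close>, is read in the field of fractions
  of \<open>\<int>[t]\<close>, where \<open>1/t\<close> makes sense. There \<open>p\<close> is evaluated at a fraction by
  embedding its integer coefficients as constants.
\<close>

definition fract_var :: "int poly fract" where
  "fract_var = to_fract [:0, 1:]"

definition fract_eval :: "int poly \<Rightarrow> int poly fract \<Rightarrow> int poly fract" where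
  "fract_eval p x = poly (map_poly (\<lambda>a. to_fract [:a:]) p) x"

definition reciprocal :: "int poly \<Rightarrow> bool" where
  "reciprocal p \<longleftrightarrow>
    fract_eval p fract_var = fract_var ^ degree p * fract_eval p (1 / fract_var)"

lemma fract_eval_var: "fract_eval p fract_var = to_fract p"
proof (induction p rule: pCons_induct)
  case 0
  show ?case by (simp add: fract_eval_def)
next
  case (pCons a p)
  have "to_fract (pCons a p) = to_fract ([:a:] + [:0, 1:] * p)"
    by simp
  also have "\<dots> = to_fract [:a:] + fract_var * to_fract p"
    by (simp only: to_fract_add to_fract_mult fract_var_def)
  finally show ?case
    using pCons by (simp add: fract_eval_def map_poly_pCons)
qed

lemma reciprocal_iff_reflect_poly: "reciprocal p \<longleftrightarrow> reflect_poly p = p"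
proof -
  let ?e = "\<lambda>a::int. to_fract [:a:]"
  have nz: "fract_var \<noteq> 0"
    by (simp add: fract_var_def)
  have deg: "degree (map_poly ?e p) = degree p"
    by (rule degree_map_poly) simp
  have "reflect_poly (map_poly ?e p) = map_poly ?e (reflect_poly p)"
    by (rule poly_eqI) (simp add: coeff_reflect_poly coeff_map_poly deg)
  then have "fract_var ^ degree p * fract_eval p (1 / fract_var) = fract_eval (reflect_poly p) fract_var"
    using poly_reflect_poly_nz [OF nz, of "map_poly ?e p"]
    by (simp add: fract_eval_def deg inverse_eq_divide)
  then show ?thesis
    by (auto simp: reciprocal_def fract_eval_var)
qed

fun stern_u :: "nat \<Rightarrow> int" where
  "stern_u 0 = 1"
| "stern_u (Suc n) = 2 ^ (8 * Suc n - 2) * stern_u n + 2 ^ (4 * Suc n) - 1"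

fun stern_v :: "nat \<Rightarrow> int" where
  "stern_v 0 = 5"
| "stern_v (Suc n) = 2 ^ (8 * Suc n + 2) * stern_v n - 2 ^ (4 * Suc n + 2) + 1"

end

theory Submission
  imports Defs
begin

text \<open>
  Fix a nonzero field element \<open>x\<close> and write \<open>f(z)\<close> for the value \<open>B\<^sub>z(x)\<close>. The linear recursion of \<open>f\<close> is symmetric under
  exchanging predecessor and successor: passing from \<open>N\<close> to \<open>2\<^sup>m\<^sup>+\<^sup>2(2\<^sup>m N + 1) - 1\<close> acts on the pair
  \<open>(f(N), f(N+1))\<close> by the same linear map \<open>T\<^sub>m\<close> by which passing from \<open>N\<close> to
  \<open>2\<^sup>m\<^sup>+\<^sup>2(2\<^sup>m N - 1) + 1\<close> acts on \<open>(f(N), f(N-1))\<close>. The step from one \<open>u\<close> to the next is of the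
  first kind, and the corresponding step for \<open>2\<^sup>k - u\<close> is of the second kind; for \<open>v\<close> the roles
  are exchanged. So in both cases one map governs the pair at \<open>N\<close> and the pair at \<open>2\<^sup>k - N\<close>.

  The substitution of \<open>1/x\<close> for \<open>x\<close> carries \<open>T\<^sub>m\<close> to itself, up to powers of \<open>x\<close>. Because of this,
  a relation
  \<open>(x - 1) B\<^sub>M(x) = x\<^sup>\<alpha> B\<^sub>N(1/x) - B\<^sub>N(x)\<close>
  with \<open>M = 2\<^sup>k - N\<close>, together with a companion relation for the neighbours of \<open>M\<close> and \<open>N\<close>, is
  inherited by the next pair (\<open>mirror_step\<close>). It holds for \<open>N = 1\<close> and for \<open>N = 5\<close>, hence for
  all \<open>u\<^sub>n\<close> and \<open>v\<^sub>n\<close>. Replacing \<open>x\<close> by \<open>1/x\<close> turns the right-hand side into its own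
  negative, up to \<open>x\<^sup>\<alpha>\<close>, so that \<open>B\<^sub>M(x) = x\<^sup>\<alpha>\<^sup>-\<^sup>1 B\<^sub>M(1/x)\<close> (\<open>mirror_self_reciprocal\<close>). As \<open>M\<close> is
  odd, \<open>B\<^sub>M\<close> has a nonzero constant term, and then \<open>\<alpha> - 1\<close> can only be its degree.
\<close>

section \<open>Mirror relations between functions on a field\<close>

definition geom :: "nat \<Rightarrow> 'a::comm_ring_1 \<Rightarrow> 'a" where
  "geom m x = (\<Sum>i<m. x ^ i)"

lemma geom_0 [simp]: "geom 0 x = 0"
  by (simp add: geom_def)

lemma geom_Suc [simp]: "geom (Suc m) x = geom m x + x ^ m"
  by (simp add: geom_def)

lemma geom_closed: "(x - 1) * geom m x = x ^ m - 1"
  by (induction m) (simp_all add: algebra_simps)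

lemma geom_inverse:
  fixes x :: "'a::field"
  assumes "x \<noteq> 0"
  shows "x ^ m * geom m (1 / x) = x * geom m x"
proof (induction m)
  case (Suc m)
  have "x ^ Suc m * geom (Suc m) (1 / x) = x * (x ^ m * geom m (1 / x)) + x"
    using assms by (simp add: algebra_simps power_divide)
  also have "\<dots> = x * (x * geom m x + 1)"
    by (simp only: Suc.IH distrib_left mult_1_right)
  also have "x * geom m x + 1 = geom (Suc m) x"
    using geom_closed[of x m] by (simp add: algebra_simps)
  finally show ?case .
qed simp

text \<open>
  The functions \<open>P\<close> for which this holds are the quotients by \<open>x - 1\<close> of the antisymmetric
  functions \<open>x\<^sup>\<alpha> a(1/x) - a(x)\<close>. In the applications \<open>a\<close> is \<open>x \<mapsto> B\<^sub>N(x)\<close> and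
  \<open>P\<close> is \<open>x \<mapsto> B\<^sub>M(x)\<close> with \<open>M = 2\<^sup>k - N\<close>, or the same for neighbours of \<open>N\<close> and \<open>M\<close>.
\<close>

definition mirror :: "nat \<Rightarrow> ('a::field \<Rightarrow> 'a) \<Rightarrow> ('a \<Rightarrow> 'a) \<Rightarrow> bool" where
  "mirror \<alpha> a P \<longleftrightarrow> (\<forall>x. x \<noteq> 0 \<longrightarrow> (x - 1) * P x = x ^ \<alpha> * a (1 / x) - a x)"

text \<open>
  The right-hand side \<open>R(x)\<close> of the relation satisfies \<open>x\<^sup>\<alpha> R(1/x) = - R(x)\<close>, and the factor
  \<open>x - 1\<close> on the left satisfies the same with exponent \<open>1\<close>; the quotient is therefore symmetric.
\<close>

lemma mirror_self_reciprocal: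
  fixes x :: "'a::field"
  assumes "mirror (Suc d) a P" "x \<noteq> 0" "x \<noteq> 1"
  shows "P x = x ^ d * P (1 / x)"
proof -
  have px: "(x - 1) * P x = x ^ Suc d * a (1 / x) - a x"
    using assms by (simp add: mirror_def)
  have py: "(1 / x - 1) * P (1 / x) = (1 / x) ^ Suc d * a x - a (1 / x)"
    using assms(1)[unfolded mirror_def, rule_format, of "1 / x"] assms(2) by simp
  have "(x - 1) * (x ^ d * P (1 / x)) = - (x ^ Suc d * ((1 / x - 1) * P (1 / x)))"
    using assms(2) by (simp add: field_simps)
  also have "\<dots> = x ^ Suc d * a (1 / x) - a x"
    unfolding py using assms(2) by (simp add: field_simps power_divide)
  finally show ?thesis
    using px assms(3) by (metis eq_iff_diff_eq_0 mult_left_cancel)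
qed

text \<open>
  These two functions are the components of the map \<open>T\<^sub>m\<close> from the pairs \<open>(f(N), f(N \<plusminus> 1))\<close> to
  themselves.
\<close>

definition step_fst :: "nat \<Rightarrow> ('a::comm_ring_1 \<Rightarrow> 'a) \<Rightarrow> ('a \<Rightarrow> 'a) \<Rightarrow> 'a \<Rightarrow> 'a" where
  "step_fst m a b x = x ^ m * a x + geom (m + 2) x * (geom m x * a x + b x)"

definition step_snd :: "nat \<Rightarrow> ('a::comm_ring_1 \<Rightarrow> 'a) \<Rightarrow> ('a \<Rightarrow> 'a) \<Rightarrow> 'a \<Rightarrow> 'a" where
  "step_snd m a b x = x ^ (m + 2) * (geom m x * a x + b x)"

text \<open>
  Put \<open>A(x) = x\<^sup>\<alpha> a(1/x)\<close> and \<open>B(x) = x\<^sup>\<beta> b(1/x)\<close>. Since \<open>x\<^sup>m\<^sup>-\<^sup>1\<close> times the geometric sum at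
  \<open>1/x\<close> is the geometric sum at \<open>x\<close>, the reversal of the image of \<open>(a, b)\<close> is the image of
  \<open>(A, B)\<close> under the same map, exactly when \<open>\<beta> = \<alpha> + m - 1\<close>. The map is linear over functions
  of \<open>x\<close>, so it preserves the relations \<open>(x - 1) P = A - a\<close> and \<open>(x - 1) Q = B - b\<close>. The new
  exponents satisfy \<open>\<beta>' = \<alpha>' + (m + 4) - 1\<close>, so the next step has to be taken with \<open>m + 4\<close>.
\<close>

lemma mirror_step:
  fixes a b P Q :: "'a::field \<Rightarrow> 'a"
  assumes aP: "mirror \<alpha> a P" and bQ: "mirror \<beta> b Q" and \<beta>: "\<beta> + 1 = \<alpha> + m"
  shows "mirror (\<alpha> + 2 * m) (step_fst m a b) (step_fst m P Q)"
    and "mirror (\<alpha> + 3 * m + 3) (step_snd m a b) (step_snd m P Q)"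
proof -
  have "(x - 1) * step_fst m P Q x
          = x ^ (\<alpha> + 2 * m) * step_fst m a b (1 / x) - step_fst m a b x \<and>
        (x - 1) * step_snd m P Q x
          = x ^ (\<alpha> + 3 * m + 3) * step_snd m a b (1 / x) - step_snd m a b x"
    if x: "x \<noteq> 0" for x
  proof -
    define y where "y = 1 / x"
    have xy: "x ^ i * y ^ i = 1" for i
      using x by (simp add: y_def power_divide)
    have P: "(x - 1) * P x = x ^ \<alpha> * a y - a x" and Q: "(x - 1) * Q x = x ^ \<beta> * b y - b x"
      using aP bQ x by (simp_all add: mirror_def y_def)
    have \<beta>': "x * x ^ \<beta> = x ^ \<alpha> * x ^ m"
      using \<beta> by (metis power_Suc power_add Suc_eq_plus1)
    have g: "x ^ i * geom i y = x * geom i x" for i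
      using geom_inverse[OF x] by (simp add: y_def)
    define q where "q = geom m y * a y + b y"
    have "x * (x ^ \<beta> * geom m y) = x * (x ^ \<alpha> * geom m x)"
      using \<beta>' g[of m] by (metis (no_types) mult.assoc mult.left_commute)
    then have "x ^ \<beta> * geom m y = x ^ \<alpha> * geom m x"
      using x by simp
    then have q: "x ^ \<beta> * q = geom m x * (x ^ \<alpha> * a y) + x ^ \<beta> * b y"
      by (simp add: q_def algebra_simps)
    have exp: "x ^ (\<alpha> + 2 * m) = x ^ \<alpha> * x ^ m * x ^ m"
      by (simp only: mult_2 power_add mult.assoc)
    then have "x * (x * (x ^ (\<alpha> + 2 * m) * geom (m + 2) y))
            = x ^ \<alpha> * x ^ m * (x ^ (m + 2) * geom (m + 2) y)"
      by (simp only: power_add power2_eq_square mult_ac)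
    also have "\<dots> = x * (x * (x ^ \<beta> * geom (m + 2) x))"
      unfolding g \<beta>'[symmetric] by (simp only: mult_ac)
    finally have G: "x ^ (\<alpha> + 2 * m) * geom (m + 2) y = x ^ \<beta> * geom (m + 2) x"
      using x by simp
    have fst: "x ^ (\<alpha> + 2 * m) * step_fst m a b y
        = x ^ m * (x ^ \<alpha> * a y) + geom (m + 2) x * (x ^ \<beta> * q)"
    proof -
      have "x ^ (\<alpha> + 2 * m) * step_fst m a b y
          = x ^ (\<alpha> + 2 * m) * (y ^ m * a y) + x ^ (\<alpha> + 2 * m) * geom (m + 2) y * q"
        by (simp only: step_fst_def q_def distrib_left mult.assoc)
      moreover have "x ^ (\<alpha> + 2 * m) * (y ^ m * a y)
          = x ^ m * (x ^ \<alpha> * a y) * (x ^ m * y ^ m)"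
        unfolding exp by (simp only: mult_ac)
      ultimately show ?thesis
        unfolding G xy by (simp only: mult_1_left mult_ac)
    qed
    have snd: "x ^ (\<alpha> + 3 * m + 3) * step_snd m a b y = x ^ (m + 2) * (x ^ \<beta> * q)"
    proof -
      have e: "\<alpha> + 3 * m + 3 = (m + 2) + (m + 2 + \<beta>)"
        using \<beta> by simp
      have "x ^ (\<alpha> + 3 * m + 3) * step_snd m a b y
          = (x ^ (m + 2) * y ^ (m + 2)) * (x ^ (m + 2) * (x ^ \<beta> * q))"
        unfolding e power_add[of x "m + 2" "m + 2 + \<beta>"] power_add[of x "m + 2" \<beta>]
        by (simp only: step_snd_def q_def mult_ac)
      then show ?thesis
        unfolding xy by simp
    qed
    have lin: "(x - 1) * (geom m x * P x + Q x) = x ^ \<beta> * q - (geom m x * a x + b x)"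
    proof -
      have "(x - 1) * (geom m x * P x + Q x) = geom m x * ((x - 1) * P x) + (x - 1) * Q x"
        by (simp add: algebra_simps)
      then show ?thesis
        unfolding P Q q by (simp add: algebra_simps)
    qed
    have "(x - 1) * step_fst m P Q x = x ^ m * ((x - 1) * P x)
            + geom (m + 2) x * ((x - 1) * (geom m x * P x + Q x))"
      unfolding step_fst_def by (simp only: distrib_left mult_ac)
    moreover have "(x - 1) * step_snd m P Q x
            = x ^ (m + 2) * ((x - 1) * (geom m x * P x + Q x))"
      unfolding step_snd_def by (simp only: mult_ac)
    ultimately show ?thesis
      unfolding lin P y_def[symmetric] fst snd step_fst_def[of m a b x] step_snd_def[of m a b x]
      by (simp only: right_diff_distrib distrib_left) simp
  qed
  then show "mirror (\<alpha> + 2 * m) (step_fst m a b) (step_fst m P Q)"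
    and "mirror (\<alpha> + 3 * m + 3) (step_snd m a b) (step_snd m P Q)"
    by (simp_all add: mirror_def)
qed

section \<open>Values of Stern polynomials\<close>

lemma fract_eval_0 [simp]: "fract_eval 0 x = 0"
  by (simp add: fract_eval_def)

lemma fract_eval_1 [simp]: "fract_eval 1 x = 1"
  by (simp add: fract_eval_def map_poly_1 flip: one_pCons)

lemma fract_eval_add: "fract_eval (p + q) x = fract_eval p x + fract_eval q x"
proof -
  have "map_poly (\<lambda>a. to_fract [:a:]) (p + q)
      = map_poly (\<lambda>a. to_fract [:a:]) p + map_poly (\<lambda>a::int. to_fract [:a:]) q"
    by (rule poly_eqI) (simp add: coeff_map_poly flip: to_fract_add)
  then show ?thesis
    by (simp add: fract_eval_def)
qed

lemma fract_eval_pCons_0: "fract_eval (pCons 0 p) x = x * fract_eval p x"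
  by (simp add: fract_eval_def map_poly_pCons)

text \<open>
  Integer indices avoid truncated subtraction in \<open>2\<^sup>k - u\<^sub>n\<close> and in the recursions; only
  nonnegative indices are meaningful.
\<close>

definition stern_val :: "int \<Rightarrow> int poly fract \<Rightarrow> int poly fract" where
  "stern_val z x = fract_eval (stern_poly (nat z)) x"

lemma stern_val_0 [simp]: "stern_val 0 x = 0"
  by (simp add: stern_val_def stern_poly.simps[of 0])

lemma stern_val_1 [simp]: "stern_val 1 x = 1"
  by (simp add: stern_val_def stern_poly.simps[of "Suc 0"])

lemma stern_val_double:
  assumes "z \<ge> 0"
  shows "stern_val (2 * z) x = x * stern_val z x"
proof (cases "z = 0")
  case False
  with assms have "nat (2 * z) \<noteq> 0" "nat (2 * z) \<noteq> 1" "even (nat (2 * z))"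
    "nat (2 * z) div 2 = nat z"
    by (simp_all add: nat_mult_distrib)
  then show ?thesis
    by (simp add: stern_val_def stern_poly.simps[of "nat (2 * z)"] fract_eval_pCons_0)
qed simp

lemma stern_val_double_plus_1:
  assumes "z \<ge> 0"
  shows "stern_val (2 * z + 1) x = stern_val z x + stern_val (z + 1) x"
proof (cases "z = 0")
  case False
  have n: "nat (2 * z + 1) = 2 * nat z + 1" "nat (z + 1) = nat z + 1"
    using assms by simp_all
  have "stern_poly (2 * nat z + 1) = stern_poly (nat z) + stern_poly (nat z + 1)"
    using False assms by (subst stern_poly.simps) simp
  then show ?thesis
    by (simp only: stern_val_def n fract_eval_add)
qed simp

lemma stern_val_power_mult:
  assumes "z \<ge> 0"
  shows "stern_val (2 ^ j * z) x = x ^ j * stern_val z x"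
proof (induction j)
  case (Suc j)
  then show ?case
    using stern_val_double[of "2 ^ j * z" x] assms by (simp add: mult.assoc)
qed simp

lemma stern_val_power_mult_plus_1:
  assumes "z \<ge> 0"
  shows "stern_val (2 ^ j * z + 1) x = geom j x * stern_val z x + stern_val (z + 1) x"
proof (induction j)
  case (Suc j)
  then show ?case
    using stern_val_double_plus_1[of "2 ^ j * z" x] assms
    by (simp add: mult.assoc stern_val_power_mult distrib_right add_ac)
qed simp

lemma stern_val_power_mult_minus_1:
  assumes "z \<ge> 1"
  shows "stern_val (2 ^ j * z - 1) x = geom j x * stern_val z x + stern_val (z - 1) x"
proof (induction j)
  case (Suc j)
  have "2 ^ j * z - 1 \<ge> 0"
    using assms by (simp add: int_one_le_iff_zero_less)
  then have "stern_val (2 * (2 ^ j * z - 1) + 1) x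
      = stern_val (2 ^ j * z - 1) x + stern_val (2 ^ j * z) x"
    using stern_val_double_plus_1[of "2 ^ j * z - 1" x] by simp
  moreover have "2 ^ Suc j * z - 1 = 2 * (2 ^ j * z - 1) + 1"
    by simp
  ultimately show ?case
    using assms by (simp only: Suc.IH) (simp add: stern_val_power_mult distrib_right)
qed simp

text \<open>
  The indices reached by the step \<open>T\<^sub>m\<close>. Since \<open>2\<^sup>k\<^sup>+\<^sup>2\<^sup>m\<^sup>+\<^sup>2\<close> minus either one is the other one
  formed with \<open>2\<^sup>k - N\<close>, a step of one kind at \<open>N\<close> is a step of the other kind at \<open>2\<^sup>k - N\<close>.
\<close>

definition step_up :: "nat \<Rightarrow> int \<Rightarrow> int" where
  "step_up m N = 2 ^ (m + 2) * (2 ^ m * N + 1) - 1"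

definition step_down :: "nat \<Rightarrow> int \<Rightarrow> int" where
  "step_down m N = 2 ^ (m + 2) * (2 ^ m * N - 1) + 1"

lemma power_minus_step_up: "2 ^ (k + 2 * m + 2) - step_up m N = step_down m (2 ^ k - N)"
proof -
  have "(2::int) ^ (k + 2 * m + 2) = 2 ^ (m + 2) * (2 ^ m * 2 ^ k)"
    by (simp only: power_add[symmetric]) (simp add: algebra_simps)
  then show ?thesis
    by (simp only: step_up_def step_down_def right_diff_distrib distrib_left)
qed

lemma power_minus_step_down: "2 ^ (k + 2 * m + 2) - step_down m N = step_up m (2 ^ k - N)"
  using power_minus_step_up[of k m "2 ^ k - N"] by simp

lemma step_up_pos:
  assumes "N \<ge> 1"
  shows "step_up m N \<ge> 1"
proof -
  have "1 * (0 + 1) < 2 ^ (m + 2) * (2 ^ m * N + 1)"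
    using assms by (intro mult_less_le_imp_less) (auto simp: one_less_power simp del: power_Suc)
  then show ?thesis
    by (simp add: step_up_def)
qed

lemma step_down_pos:
  assumes "N \<ge> 1"
  shows "step_down m N \<ge> 1"
proof -
  have "2 ^ m * N \<ge> 1"
    using assms by (simp add: int_one_le_iff_zero_less)
  then show ?thesis
    by (simp add: step_down_def)
qed

lemma stern_val_step_up:
  assumes "N \<ge> 1"
  shows "stern_val (step_up m N) = step_fst m (stern_val N) (stern_val (N + 1))"
    and "stern_val (step_up m N + 1) = step_snd m (stern_val N) (stern_val (N + 1))"
proof -
  have "2 ^ m * N \<ge> 0"
    using assms by simp
  then show "stern_val (step_up m N) = step_fst m (stern_val N) (stern_val (N + 1))"
    and "stern_val (step_up m N + 1) = step_snd m (stern_val N) (stern_val (N + 1))"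
    using assms stern_val_power_mult_minus_1[of "2 ^ m * N + 1" "m + 2"]
      stern_val_power_mult[of "2 ^ m * N + 1" "m + 2"]
    by (simp_all add: fun_eq_iff step_up_def step_fst_def step_snd_def stern_val_power_mult
        stern_val_power_mult_plus_1)
qed

lemma stern_val_step_down:
  assumes "N \<ge> 1"
  shows "stern_val (step_down m N) = step_fst m (stern_val N) (stern_val (N - 1))"
    and "stern_val (step_down m N - 1) = step_snd m (stern_val N) (stern_val (N - 1))"
proof -
  have "2 ^ m * N \<ge> 1"
    using assms by (simp add: int_one_le_iff_zero_less)
  then show "stern_val (step_down m N) = step_fst m (stern_val N) (stern_val (N - 1))"
    and "stern_val (step_down m N - 1) = step_snd m (stern_val N) (stern_val (N - 1))"
    using assms stern_val_power_mult_plus_1[of "2 ^ m * N - 1" "m + 2"]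
      stern_val_power_mult[of "2 ^ m * N - 1" "m + 2"]
    by (simp_all add: fun_eq_iff step_down_def step_fst_def step_snd_def stern_val_power_mult
        stern_val_power_mult_minus_1)
qed

section \<open>Mirror relations for the two sequences\<close>

lemma stern_u_Suc: "stern_u (Suc n) = step_up (4 * n + 2) (stern_u n)"
proof -
  have "(2::int) ^ (8 * Suc n - 2) = 2 ^ (4 * n + 4) * 2 ^ (4 * n + 2)"
    by (simp only: power_add[symmetric]) simp
  then show ?thesis
    by (simp add: step_up_def algebra_simps power_add)
qed

lemma stern_v_Suc: "stern_v (Suc n) = step_down (4 * n + 4) (stern_v n)"
proof -
  have "(2::int) ^ (8 * Suc n + 2) = 2 ^ (4 * n + 6) * 2 ^ (4 * n + 4)"
    by (simp only: power_add[symmetric]) simp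
  then show ?thesis
    by (simp add: step_down_def algebra_simps)
qed

lemma stern_u_pos: "stern_u n \<ge> 1"
  by (induction n) (simp_all only: stern_u_Suc step_up_pos stern_u.simps(1) order_refl)

lemma stern_v_pos: "stern_v n \<ge> 1"
  by (induction n) (simp_all only: stern_v_Suc step_down_pos, simp)

lemma odd_stern_u: "odd (stern_u n)"
  by (cases n) auto

lemma odd_stern_v: "odd (stern_v n)"
  by (cases n) auto

text \<open>
  The exponents are dictated by the step: \<open>k\<close> grows by \<open>2 m + 2\<close> while \<open>\<alpha>\<close> grows by \<open>2 m\<close>, so
  \<open>\<alpha> - k\<close> drops by \<open>2\<close> each time. The condition on \<open>k\<close> is the sum of these growths, started
  from \<open>k \<ge> 1\<close>, the least \<open>k\<close> with \<open>1 < 2\<^sup>k\<close>.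
\<close>

lemma mirror_stern_u:
  assumes "k \<ge> 4 * n ^ 2 + 2 * n + 1"
  shows "stern_u n < 2 ^ k \<and>
    mirror (k - 2 * n) (stern_val (stern_u n)) (stern_val (2 ^ k - stern_u n)) \<and>
    mirror (k + 2 * n + 1) (stern_val (stern_u n + 1)) (stern_val (2 ^ k - stern_u n - 1))"
  using assms
proof (induction n arbitrary: k)
  case 0
  then obtain i where k: "k = Suc i"
    by (metis add_is_0 le_Suc_ex not0_implies_Suc numeral_One plus_1_eq_Suc zero_neq_numeral)
  have top: "stern_val (2 ^ j - 1) x = geom j x" for j x
    using stern_val_power_mult_minus_1[of 1 j x] by simp
  have two: "stern_val 2 x = x" for x
    using stern_val_double[of 1 x] by simp
  have "stern_val (2 ^ k - 2) x = x * geom i x" for x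
    using stern_val_double[of "2 ^ i - 1" x] by (simp add: k top)
  then have "mirror (k + 1) (stern_val 2) (stern_val (2 ^ k - 2))"
    by (simp add: mirror_def two mult.left_commute[of "_ - 1"] geom_closed)
      (simp add: k algebra_simps)
  moreover have "mirror k (stern_val 1) (stern_val (2 ^ k - 1))"
    by (simp add: mirror_def top geom_closed)
  moreover have "(1::int) < 2 ^ k"
    unfolding k by (rule one_less_power) simp_all
  ultimately show ?case
    by (simp del: stern_val_1)
next
  case (Suc n)
  \<comment> \<open>The step with \<open>m\<close> lengthens indices by \<open>2 m + 2\<close> bits, so the preceding pair lives below \<open>2\<^sup>l\<close>.\<close>
  define l where "l = k - (8 * n + 6)"
  define m where "m = 4 * n + 2"
  have l: "l \<ge> 4 * n ^ 2 + 2 * n + 1" and k: "k = l + 2 * m + 2"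
    using Suc.prems by (simp_all add: l_def m_def power2_eq_square)
  from l have l': "l \<ge> 2 * n"
    by linarith
  let ?u = "stern_u n" and ?w = "2 ^ l - stern_u n"
  have w: "?w \<ge> 1"
    using Suc.IH[OF l] by linarith
  have w': "2 ^ k - stern_u (Suc n) = step_down m ?w"
    by (simp only: k stern_u_Suc m_def[symmetric] power_minus_step_up)
  have e: "(l + 2 * n + 1) + 1 = (l - 2 * n) + m"
    using l' by (simp add: m_def)
  have e': "(l - 2 * n) + 2 * m = k - 2 * Suc n" "(l - 2 * n) + 3 * m + 3 = k + 2 * Suc n + 1"
    using l' by (simp_all add: k m_def)
  have a: "mirror (l - 2 * n) (stern_val ?u) (stern_val ?w)"
    and b: "mirror (l + 2 * n + 1) (stern_val (?u + 1)) (stern_val (?w - 1))"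
    using Suc.IH[OF l] by simp_all
  show ?case
    using mirror_step[OF a b e] step_down_pos[OF w, of m]
    by (simp only: w'[symmetric] stern_u_Suc m_def[symmetric] e' flip:
        stern_val_step_up[OF stern_u_pos] stern_val_step_down[OF w]) simp
qed

text \<open>
  Here the distinguished neighbour of \<open>v\<^sub>n\<close> is \<open>v\<^sub>n - 1\<close>, because the last digits are
  attached by a step down. The induction starts from \<open>k \<ge> 3\<close>, the least \<open>k\<close> with \<open>5 < 2\<^sup>k\<close>.
\<close>

lemma mirror_stern_v:
  assumes "k \<ge> 4 * n ^ 2 + 6 * n + 3"
  shows "stern_v n < 2 ^ k \<and>
    mirror (k - (2 * n + 1)) (stern_val (stern_v n)) (stern_val (2 ^ k - stern_v n)) \<and>
    mirror (k + 2 * n + 2) (stern_val (stern_v n - 1)) (stern_val (2 ^ k - stern_v n + 1))"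
  using assms
proof (induction n arbitrary: k)
  case 0
  then obtain i where k: "k = i + 3"
    by (metis add.commute le_Suc_ex mult_0_right mult_zero_right add_0 power_zero_numeral)
  have p: "(2::int) ^ i \<ge> 1"
    by simp
  have top: "stern_val (2 ^ j - 1) x = geom j x" for j x
    using stern_val_power_mult_minus_1[of 1 j x] by simp
  have top2: "stern_val (2 * 2 ^ j - 2) x = x * geom j x" for j x
    using stern_val_double[of "2 ^ j - 1" x] by (simp add: top)
  have top4: "stern_val (8 * 2 ^ i - 4) x = x ^ 2 * geom (Suc i) x" for x
    using stern_val_double[of "4 * 2 ^ i - 2" x] top2[of "Suc i" x] p by (simp add: power2_eq_square)
  have top3: "stern_val (4 * 2 ^ i - 3) x = x * geom i x + geom (Suc i) x" for x
    using stern_val_double_plus_1[of "2 * 2 ^ i - 2" x] p top2[of i x] top[of "Suc i" x] by simp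
  have top5: "stern_val (8 * 2 ^ i - 5) x
      = (x * geom i x + geom (Suc i) x) + x * geom (Suc i) x" for x
    using stern_val_double_plus_1[of "4 * 2 ^ i - 3" x] p top3[of x] top2[of "Suc i" x] by simp
  have two: "stern_val 2 x = x" and four: "stern_val 4 x = x ^ 2"
    and three: "stern_val 3 x = 1 + x" and five: "stern_val 5 x = 2 * x + 1" for x
  proof -
    show 2: "stern_val 2 x = x"
      using stern_val_double[of 1 x] by simp
    then show "stern_val 4 x = x ^ 2"
      using stern_val_double[of 2 x] by (simp add: power2_eq_square)
    show 3: "stern_val 3 x = 1 + x"
      using stern_val_double_plus_1[of 1 x] 2 by simp
    show "stern_val 5 x = 2 * x + 1"
      using stern_val_double_plus_1[of 2 x] 2 3 by simp
  qed
  have c: "(x - 1) * geom j x = x ^ j - 1" for j and x :: "int poly fract"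
    by (rule geom_closed)
  have "mirror (k + 2) (stern_val 4) (stern_val (8 * 2 ^ i - 4))"
    unfolding mirror_def top4 four
    by (simp only: mult.left_commute[of "_ - 1"] c)
      (simp add: k power_add algebra_simps power2_eq_square eval_nat_numeral)
  moreover have "mirror (k - 1) (stern_val 5) (stern_val (8 * 2 ^ i - 5))"
    unfolding mirror_def top5 five
    by (simp only: mult.left_commute[of "_ - 1"] c distrib_left)
      (simp add: k power_add algebra_simps power2_eq_square eval_nat_numeral)
  moreover have "(2::int) ^ k = 8 * 2 ^ i"
    by (simp add: k power_add)
  moreover have "5 < 8 * (2::int) ^ i"
    using p by linarith
  ultimately show ?case
    by simp
next
  case (Suc n)
  define l where "l = k - (8 * n + 10)"
  define m where "m = 4 * n + 4"
  have l: "l \<ge> 4 * n ^ 2 + 6 * n + 3" and k: "k = l + 2 * m + 2"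
    using Suc.prems by (simp_all add: l_def m_def power2_eq_square)
  from l have l': "l \<ge> 2 * n + 1"
    by linarith
  let ?v = "stern_v n" and ?w = "2 ^ l - stern_v n"
  have w: "?w \<ge> 1"
    using Suc.IH[OF l] by linarith
  have w': "2 ^ k - stern_v (Suc n) = step_up m ?w"
    by (simp only: k stern_v_Suc m_def[symmetric] power_minus_step_down)
  have e: "(l + 2 * n + 2) + 1 = (l - (2 * n + 1)) + m"
    using l' by (simp add: m_def)
  have e': "(l - (2 * n + 1)) + 2 * m = k - (2 * Suc n + 1)"
    "(l - (2 * n + 1)) + 3 * m + 3 = k + 2 * Suc n + 2"
    using l' by (simp_all add: k m_def)
  have a: "mirror (l - (2 * n + 1)) (stern_val ?v) (stern_val ?w)"
    and b: "mirror (l + 2 * n + 2) (stern_val (?v - 1)) (stern_val (?w + 1))"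
    using Suc.IH[OF l] by simp_all
  show ?case
    using mirror_step[OF a b e] step_up_pos[OF w, of m]
    by (simp only: w'[symmetric] stern_v_Suc m_def[symmetric] e' flip:
        stern_val_step_down[OF stern_v_pos] stern_val_step_up[OF w]) simp
qed

section \<open>From mirror relations to reciprocal polynomials\<close>

lemma coeff_stern_poly_0: "coeff (stern_poly n) 0 = of_bool (odd n)"
proof (induction n rule: less_induct)
  case (less n)
  show ?case
  proof (cases "even n \<or> n = 1")
    case True
    then show ?thesis
      by (subst stern_poly.simps) auto
  next
    case False
    then have "odd n"
      by simp
    then obtain j where n: "n = 2 * j + 1"
      by (rule oddE)
    with False have "j \<ge> 1"
      by (cases j) auto
    then have "stern_poly n = stern_poly (j + 1) + stern_poly j"
      unfolding n by (subst stern_poly.simps) simp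
    moreover have "coeff (stern_poly j) 0 = of_bool (odd j)"
      and "coeff (stern_poly (j + 1)) 0 = of_bool (odd (j + 1))"
      by (rule less.IH, use n \<open>j \<ge> 1\<close> in linarith)+
    ultimately show ?thesis
      by (simp only: coeff_add) (simp add: n)
  qed
qed

text \<open>
  Both \<open>p\<close> and its coefficient reversal have nonzero constant term, so comparing
  \<open>t\<^bsup>deg p\<^esup> p\<close> with \<open>t\<^sup>d\<close> times the reversal forces \<open>d\<close> to be the degree.
\<close>

lemma reciprocal_if_symmetric:
  assumes sym: "to_fract p = fract_var ^ d * fract_eval p (1 / fract_var)"
    and p0: "coeff p 0 \<noteq> 0"
  shows "reciprocal p"
proof -
  let ?e = "\<lambda>a::int. to_fract [:a:]"
  have nz: "fract_var \<noteq> 0"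
    by (simp add: fract_var_def)
  have deg: "degree (map_poly ?e p) = degree p"
    by (rule degree_map_poly) simp
  have "reflect_poly (map_poly ?e p) = map_poly ?e (reflect_poly p)"
    by (rule poly_eqI) (simp add: coeff_reflect_poly coeff_map_poly deg)
  then have "fract_var ^ degree p * fract_eval p (1 / fract_var)
      = fract_eval (reflect_poly p) fract_var"
    using poly_reflect_poly_nz[OF nz, of "map_poly ?e p"]
    by (simp add: fract_eval_def deg inverse_eq_divide)
  then have refl: "fract_var ^ degree p * fract_eval p (1 / fract_var) = to_fract (reflect_poly p)"
    by (simp only: fract_eval_var)
  have pow: "fract_var ^ i = to_fract (monom 1 i)" for i
    by (induction i) (simp_all add: fract_var_def monom_Suc monom_0 flip: to_fract_mult one_pCons)
  have "to_fract (monom 1 (degree p) * p) = to_fract (monom 1 d * reflect_poly p)"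
    by (simp only: to_fract_mult sym refl[symmetric] mult_ac flip: pow)
  then have eq: "monom 1 (degree p) * p = monom 1 d * reflect_poly p"
    by (simp only: to_fract_eq_iff)
  have r0: "coeff (reflect_poly p) 0 \<noteq> 0"
    using p0 by auto
  have "degree p = d"
  proof (rule linorder_cases)
    assume less: "degree p < d"
    have "coeff (monom 1 (degree p) * p) (degree p) = 0"
      unfolding eq using less by (simp add: coeff_monom_mult)
    then show ?thesis
      using p0 by (simp add: coeff_monom_mult)
  next
    assume less: "d < degree p"
    have "coeff (monom 1 d * reflect_poly p) d = 0"
      unfolding eq[symmetric] using less by (simp add: coeff_monom_mult)
    then show ?thesis
      using r0 by (simp add: coeff_monom_mult)
  qed
  then show ?thesis
    using sym by (simp add: reciprocal_def fract_eval_var)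
qed

lemma reciprocal_if_mirror:
  assumes "mirror \<alpha> a (stern_val z)" "\<alpha> \<ge> 1" "odd z" "z \<ge> 0"
  shows "reciprocal (stern_poly (nat z))"
proof (rule reciprocal_if_symmetric)
  obtain d where "\<alpha> = Suc d"
    using assms(2) by (cases \<alpha>) auto
  moreover have "fract_var \<noteq> 0"
    by (simp add: fract_var_def)
  moreover have "fract_var \<noteq> 1"
  proof -
    have "[:0, 1:] \<noteq> (1 :: int poly)"
      by (simp add: one_pCons)
    then show ?thesis
      by (metis fract_var_def to_fract_1 to_fract_eq_iff)
  qed
  ultimately show "to_fract (stern_poly (nat z))
      = fract_var ^ (\<alpha> - 1) * fract_eval (stern_poly (nat z)) (1 / fract_var)"
    using mirror_self_reciprocal[of d a "stern_val z" fract_var] assms(1)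
    by (simp add: stern_val_def fract_eval_var)
  show "coeff (stern_poly (nat z)) 0 \<noteq> 0"
    using assms(3,4) by (simp add: coeff_stern_poly_0 even_nat_iff)
qed

theorem theorem4p1:
  fixes n :: nat
  shows "(\<forall>k::nat. k \<ge> 4 * n ^ 2 + 6 * n + 3 \<longrightarrow>
            stern_v n < 2 ^ k \<and> reciprocal (stern_poly (nat (2 ^ k - stern_v n)))) \<and>
         (\<forall>k::nat. k \<ge> 4 * n ^ 2 + 2 * n + 1 \<longrightarrow>
            stern_u n < 2 ^ k \<and> reciprocal (stern_poly (nat (2 ^ k - stern_u n))))"
proof (intro conjI allI impI)
  fix k :: nat
  assume k: "k \<ge> 4 * n ^ 2 + 6 * n + 3"
  note v = mirror_stern_v[OF k]
  then show "stern_v n < 2 ^ k"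
    by simp
  have "k > 0" "k - (2 * n + 1) \<ge> 1"
    using k by linarith+
  then show "reciprocal (stern_poly (nat (2 ^ k - stern_v n)))"
    using v odd_stern_v[of n]
    by (intro reciprocal_if_mirror[of "k - (2 * n + 1)" "stern_val (stern_v n)"]) auto
next
  fix k :: nat
  assume k: "k \<ge> 4 * n ^ 2 + 2 * n + 1"
  note u = mirror_stern_u[OF k]
  then show "stern_u n < 2 ^ k"
    by simp
  have "k > 0" "k - 2 * n \<ge> 1"
    using k by linarith+
  then show "reciprocal (stern_poly (nat (2 ^ k - stern_u n)))"
    using u odd_stern_u[of n]
    by (intro reciprocal_if_mirror[of "k - 2 * n" "stern_val (stern_u n)"]) auto
qed

end
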